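(* Every free group $F$ is subgroup conjugacy separable; that is, for any two finitely generated subgroups $H_1,H_2\leqslant F$ that are not conjugate in $F$, there exists a homomorphism $\phi$ from $F$ to a finite group $\overline{G}$ such that $\phi(H_1)$ is not conjugate to $\phi(H_2)$ in $\overline{G}$.
   Context: A group $G$ is called subgroup conjugacy separable (SCS) if for any two finitely generated non-conjugate subgroups $H_1,H_2\leqslant G$ there exists a homomorphism $\phi$ from $G$ to a finite group $\overline{G}$ such that $\phi(H_1)$ is not conjugate to $\phi(H_2)$ in $\overline{G}$. The free group is of arbitrary rank. *)

theory Defs
  imports "HOL-Algebra.Algebra"
begin

section \<open>Free groups\<close>

text \<open>
  A word over a set \<open>S\<close> is a list of signed letters: \<open>(x, True)\<close> stands for \<open>x\<close> and
  \<open>(x, False)\<close> for its formal inverse.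
\<close>

definition cancelling :: "'x \<times> bool \<Rightarrow> 'x \<times> bool \<Rightarrow> bool" where
  "cancelling a b \<longleftrightarrow> fst a = fst b \<and> snd a \<noteq> snd b"

definition reduced_words :: "'x set \<Rightarrow> ('x \<times> bool) list set" where
  "reduced_words S = {w \<in> lists (S \<times> UNIV). successively (\<lambda>a b. \<not> cancelling a b) w}"

fun letter_val :: "('a, 'b) monoid_scheme \<Rightarrow> ('x \<Rightarrow> 'a) \<Rightarrow> 'x \<times> bool \<Rightarrow> 'a" where
  "letter_val G f (x, e) = (if e then f x else inv\<^bsub>G\<^esub> (f x))"

fun word_val :: "('a, 'b) monoid_scheme \<Rightarrow> ('x \<Rightarrow> 'a) \<Rightarrow> ('x \<times> bool) list \<Rightarrow> 'a" where
  "word_val G f [] = \<one>\<^bsub>G\<^esub>"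
| "word_val G f (a # w) = letter_val G f a \<otimes>\<^bsub>G\<^esub> word_val G f w"

text \<open>
  \<open>S\<close> is a basis of \<open>G\<close> if every element of \<open>G\<close> is the value of exactly one reduced word
  over \<open>S\<close>. The set \<open>S\<close> may have any cardinality. The universal property is
  \<open>free_basis_universal\<close> below; it cannot serve as the definition, since it quantifies over
  target groups of every type.
\<close>

definition free_basis :: "('a, 'b) monoid_scheme \<Rightarrow> 'a set \<Rightarrow> bool" where
  "free_basis G S \<longleftrightarrow>
     S \<subseteq> carrier G \<and> bij_betw (word_val G (\<lambda>x. x)) (reduced_words S) (carrier G)"

definition free_group :: "('a, 'b) monoid_scheme \<Rightarrow> bool" where
  "free_group G \<longleftrightarrow> group G \<and> (\<exists>S. free_basis G S)"


section \<open>Subgroup conjugacy separability\<close>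

definition finitely_generated_subgroup :: "('a, 'b) monoid_scheme \<Rightarrow> 'a set \<Rightarrow> bool" where
  "finitely_generated_subgroup G H \<longleftrightarrow>
     subgroup H G \<and> (\<exists>A. finite A \<and> A \<subseteq> carrier G \<and> H = generate G A)"

definition conjugate_subgroups :: "('a, 'b) monoid_scheme \<Rightarrow> 'a set \<Rightarrow> 'a set \<Rightarrow> bool" where
  "conjugate_subgroups G H K \<longleftrightarrow>
     (\<exists>g \<in> carrier G. K = g <#\<^bsub>G\<^esub> H #>\<^bsub>G\<^esub> (inv\<^bsub>G\<^esub> g))"

text \<open>
  The finite group \<open>Q\<close> is taken with carrier in \<open>nat\<close>, because a type cannot be quantified
  existentially. This loses nothing: see \<open>finite_group_iso_nat\<close> below.
\<close>

definition subgroup_conjugacy_separable :: "('a, 'b) monoid_scheme \<Rightarrow> bool" where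
  "subgroup_conjugacy_separable G \<longleftrightarrow> group G \<and>
     (\<forall>H1 H2. finitely_generated_subgroup G H1 \<longrightarrow> finitely_generated_subgroup G H2 \<longrightarrow>
        \<not> conjugate_subgroups G H1 H2 \<longrightarrow>
        (\<exists>(Q :: nat monoid) \<phi>. group Q \<and> finite (carrier Q) \<and> \<phi> \<in> hom G Q \<and>
           \<not> conjugate_subgroups Q (\<phi> ` H1) (\<phi> ` H2)))"


section \<open>Adequacy of the definitions\<close>

definition cons_reduce :: "'x \<times> bool \<Rightarrow> ('x \<times> bool) list \<Rightarrow> ('x \<times> bool) list" where
  "cons_reduce a w = (if w \<noteq> [] \<and> cancelling a (hd w) then tl w else a # w)"

lemma cons_reduce_reduced:
  assumes "a \<in> S \<times> UNIV" "w \<in> reduced_words S"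
  shows "cons_reduce a w \<in> reduced_words S"
  using assms by (cases w) (auto simp: cons_reduce_def reduced_words_def successively_Cons)

lemma foldr_cons_reduce_reduced:
  assumes "w \<in> lists (S \<times> UNIV)"
  shows "foldr cons_reduce w [] \<in> reduced_words S"
  using assms
proof (induction w)
  case Nil
  show ?case by (simp add: reduced_words_def)
next
  case (Cons a w)
  then show ?case by (auto intro!: cons_reduce_reduced)
qed

context group
begin

lemma letter_val_closed:
  "f \<in> S \<rightarrow> carrier G \<Longrightarrow> a \<in> S \<times> UNIV \<Longrightarrow> letter_val G f a \<in> carrier G"
  by (cases a) auto

lemma word_val_closed:
  "f \<in> S \<rightarrow> carrier G \<Longrightarrow> w \<in> lists (S \<times> UNIV) \<Longrightarrow> word_val G f w \<in> carrier G"
proof (induction w)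
  case (Cons a w)
  then show ?case using letter_val_closed[of f S a] by simp
qed simp

lemma word_val_append:
  assumes "f \<in> S \<rightarrow> carrier G" "v \<in> lists (S \<times> UNIV)" "w \<in> lists (S \<times> UNIV)"
  shows "word_val G f (v @ w) = word_val G f v \<otimes> word_val G f w"
  using assms(2)
proof (induction v)
  case Nil
  then show ?case using word_val_closed[OF assms(1,3)] by simp
next
  case (Cons a v)
  then have "letter_val G f a \<in> carrier G" "word_val G f v \<in> carrier G"
    using letter_val_closed[OF assms(1)] word_val_closed[OF assms(1)] by auto
  then show ?case using Cons word_val_closed[OF assms(1,3)] by (simp add: m_assoc)
qed

lemma word_val_cons_reduce:
  assumes f: "f \<in> S \<rightarrow> carrier G" and a: "a \<in> S \<times> UNIV" and w: "w \<in> lists (S \<times> UNIV)"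
  shows "word_val G f (cons_reduce a w) = letter_val G f a \<otimes> word_val G f w"
proof (cases "w \<noteq> [] \<and> cancelling a (hd w)")
  case True
  then obtain b v where bv: "w = b # v" "cancelling a b" by (cases w) auto
  have v: "word_val G f v \<in> carrier G" using word_val_closed[OF f, of v] w bv by auto
  have fa: "f (fst a) \<in> carrier G" using f a by auto
  have "letter_val G f a \<otimes> letter_val G f b = \<one>"
    using bv(2) fa by (cases a; cases b) (auto simp: cancelling_def)
  moreover have "letter_val G f a \<in> carrier G" "letter_val G f b \<in> carrier G"
    using letter_val_closed[OF f] a w bv by auto
  ultimately have "letter_val G f a \<otimes> word_val G f w = word_val G f v"
    using v bv by (simp add: m_assoc[symmetric])
  then show ?thesis using True bv by (simp add: cons_reduce_def)
next
  case False
  then have "cons_reduce a w = a # w" by (simp only: cons_reduce_def if_False)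
  then show ?thesis by simp
qed

lemma word_val_foldr_cons_reduce:
  assumes f: "f \<in> S \<rightarrow> carrier G" and w: "w \<in> lists (S \<times> UNIV)"
  shows "word_val G f (foldr cons_reduce w []) = word_val G f w"
  using w
proof (induction w)
  case (Cons a w)
  then have "foldr cons_reduce w [] \<in> lists (S \<times> UNIV)"
    using foldr_cons_reduce_reduced[of w S] by (auto simp: reduced_words_def)
  then show ?case using Cons word_val_cons_reduce[OF f] by auto
qed simp

end

lemma hom_word_val:
  assumes "group G" "group H" "h \<in> hom G H" "f \<in> S \<rightarrow> carrier G" "w \<in> lists (S \<times> UNIV)"
  shows "h (word_val G f w) = word_val H (h \<circ> f) w"
proof -
  interpret group_hom G H h
    using assms by (simp add: group_hom_def group_hom_axioms_def)
  have l: "h (letter_val G f a) = letter_val H (h \<circ> f) a" if "a \<in> S \<times> UNIV" for a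
    using that assms(4) by (cases a) (auto simp: Pi_iff)
  show ?thesis using assms(5)
  proof (induction w)
    case (Cons a w)
    then show ?case
      using l G.letter_val_closed[OF assms(4)] G.word_val_closed[OF assms(4)] by (simp add: comp_def)
  qed simp
qed

lemma word_val_cong:
  assumes "w \<in> lists (S \<times> UNIV)" "\<And>x. x \<in> S \<Longrightarrow> f x = g x"
  shows "word_val G f w = word_val G g w"
  using assms by (induction w) auto

theorem free_basis_universal:
  fixes G :: "('a, 'b) monoid_scheme" and H :: "('c, 'd) monoid_scheme"
  assumes G: "group G" and S: "free_basis G S" and H: "group H" and f: "f \<in> S \<rightarrow> carrier H"
  shows "\<exists>h \<in> hom G H. (\<forall>x \<in> S. h x = f x) \<and>
           (\<forall>h' \<in> hom G H. (\<forall>x \<in> S. h' x = f x) \<longrightarrow> (\<forall>g \<in> carrier G. h' g = h g))"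
proof -
  interpret G: group G by (rule G)
  interpret H: group H by (rule H)
  let ?v = "word_val G (\<lambda>x. x)"
  have i: "(\<lambda>x. x) \<in> S \<rightarrow> carrier G" and bij: "bij_betw ?v (reduced_words S) (carrier G)"
    using S by (auto simp: free_basis_def)
  have red: "w \<in> lists (S \<times> UNIV)" if "w \<in> reduced_words S" for w
    using that by (auto simp: reduced_words_def)
  define wd where "wd = the_inv_into (reduced_words S) ?v"
  have wd: "wd g \<in> reduced_words S" "?v (wd g) = g" if "g \<in> carrier G" for g
    using that bij the_inv_into_into[of ?v "reduced_words S" g]
      f_the_inv_into_f_bij_betw[OF bij, of g]
    by (auto simp: wd_def bij_betw_def)
  have wd_v: "wd (?v w) = w" if "w \<in> reduced_words S" for w
    using that bij by (simp add: wd_def bij_betw_def the_inv_into_f_f)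
  define h where "h g = word_val H f (wd g)" for g
  have hv: "h (?v w) = word_val H f w" if w: "w \<in> lists (S \<times> UNIV)" for w
    using wd_v[OF foldr_cons_reduce_reduced[OF w]] w
      G.word_val_foldr_cons_reduce[OF i w] H.word_val_foldr_cons_reduce[OF f w]
    by (simp add: h_def)
  have hom: "h \<in> hom G H"
  proof (rule homI)
    fix x assume x: "x \<in> carrier G"
    show "h x \<in> carrier H" unfolding h_def
      by (rule H.word_val_closed[OF f red[OF wd(1)[OF x]]])
  next
    fix x y assume x: "x \<in> carrier G" and y: "y \<in> carrier G"
    note wx = red[OF wd(1)[OF x]] and wy = red[OF wd(1)[OF y]]
    have "h (x \<otimes>\<^bsub>G\<^esub> y) = h (?v (wd x @ wd y))"
      using G.word_val_append[OF i wx wy] wd(2)[OF x] wd(2)[OF y] by simp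
    also have "\<dots> = word_val H f (wd x @ wd y)"
      using wx wy by (intro hv) simp
    also have "\<dots> = h x \<otimes>\<^bsub>H\<^esub> h y"
      using H.word_val_append[OF f wx wy] by (simp add: h_def)
    finally show "h (x \<otimes>\<^bsub>G\<^esub> y) = h x \<otimes>\<^bsub>H\<^esub> h y" .
  qed
  have ext: "h x = f x" if "x \<in> S" for x
    using hv[of "[(x, True)]"] that i f by (auto simp: Pi_iff)
  have "h' g = h g"
    if h': "h' \<in> hom G H" "\<forall>x \<in> S. h' x = f x" and g: "g \<in> carrier G" for h' g
  proof -
    note w = red[OF wd(1)[OF g]]
    have "h' g = word_val H (h' \<circ> (\<lambda>x. x)) (wd g)"
      using hom_word_val[OF G H h'(1) i w] wd(2)[OF g] by simp
    also have "\<dots> = h g"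
      unfolding h_def using h'(2) by (intro word_val_cong[OF w]) simp
    finally show ?thesis .
  qed
  with hom ext show ?thesis by blast
qed

theorem finite_group_iso_nat:
  fixes K :: "('a, 'b) monoid_scheme"
  assumes "group K" "finite (carrier K)"
  shows "\<exists>Q :: nat monoid. group Q \<and> finite (carrier Q) \<and> K \<cong> Q"
proof -
  interpret group K by fact
  obtain r :: "'a \<Rightarrow> nat" where r: "inj_on r (carrier K)"
    using finite_imp_inj_to_nat_seg[OF assms(2)] by blast
  define u where "u = the_inv_into (carrier K) r"
  have u: "u (r x) = x" if "x \<in> carrier K" for x
    using that r by (simp add: u_def the_inv_into_f_f)
  define Q :: "nat monoid" where
    "Q = \<lparr>carrier = r ` carrier K, monoid.mult = (\<lambda>x y. r (u x \<otimes>\<^bsub>K\<^esub> u y)), one = r \<one>\<^bsub>K\<^esub>\<rparr>"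
  have "group Q"
  proof (rule groupI)
    fix x assume "x \<in> carrier Q"
    then obtain a where a: "a \<in> carrier K" "x = r a" by (auto simp: Q_def)
    then show "\<exists>y \<in> carrier Q. y \<otimes>\<^bsub>Q\<^esub> x = \<one>\<^bsub>Q\<^esub>"
      by (intro bexI[of _ "r (inv\<^bsub>K\<^esub> a)"]) (auto simp: Q_def u)
  qed (auto simp: Q_def u m_assoc)
  moreover have "r \<in> iso K Q"
    using r by (auto intro!: isoI homI simp: Q_def u bij_betw_def)
  ultimately show ?thesis
    using assms(2) by (auto simp: is_iso_def Q_def)
qed

end

theory Submission
  imports Defs "HOL-Library.Sublist" "HOL-Algebra.Sym_Groups"
begin

text \<open>
  Let \<open>H\<close>, \<open>K\<close> be finitely generated with no conjugate of \<open>H\<close> contained in \<open>K\<close>. It suffices to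
  find a finite \<open>F\<close>-set in which \<open>K\<close> fixes a point and \<open>H\<close> fixes none: the images of \<open>H\<close> and \<open>K\<close>
  in its symmetric group are then not conjugate. Take a finite part \<open>Y\<close> of the coset graph
  \<open>F/K\<close> that contains the paths of generators of \<open>K\<close> from the base point, and join the edges
  leaving \<open>Y\<close> to those entering it through pairwise disjoint copies of a finite Cayley graph
  of large girth, each cut open at one edge. A short reduced path that leaves \<open>Y\<close> cannot come
  back. After conjugation \<open>H\<close> contains a nontrivial element that is a short cyclically reduced
  word, so that its fixed points lie in \<open>Y\<close>; a fixed point of \<open>H\<close> in \<open>Y\<close> is then fixed already
  in \<open>F/K\<close>, which would conjugate \<open>H\<close> into \<open>K\<close>.

  It remains to treat the case that \<open>H\<close> and \<open>K\<close> are conjugate into each other. Since finitely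
  generated subgroups are separable, \<open>H\<close> is not conjugate to a proper subgroup of itself, and
  then \<open>H\<close> and \<open>K\<close> are conjugate.
\<close>


section \<open>Words acting by permutations\<close>

definition perm_group :: "'p set \<Rightarrow> ('p \<Rightarrow> 'p) monoid" where
  "perm_group V = \<lparr>carrier = {p. p permutes V}, monoid.mult = (\<circ>), one = id\<rparr>"

lemma perm_group_simps [simp]:
  "carrier (perm_group V) = {p. p permutes V}"
  "p \<otimes>\<^bsub>perm_group V\<^esub> q = p \<circ> q"
  "\<one>\<^bsub>perm_group V\<^esub> = id"
  by (simp_all add: perm_group_def)

lemma group_perm_group: "group (perm_group V)"
proof (rule groupI)
  fix p assume "p \<in> carrier (perm_group V)"
  then show "\<exists>q \<in> carrier (perm_group V). q \<otimes>\<^bsub>perm_group V\<^esub> p = \<one>\<^bsub>perm_group V\<^esub>"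
    by (intro bexI[of _ "inv' p"]) (auto simp: permutes_inv permutes_inv_o)
qed (auto simp: permutes_compose permutes_id comp_assoc)

lemma inv_perm_group: "p permutes V \<Longrightarrow> inv\<^bsub>perm_group V\<^esub> p = inv' p"
  by (rule group.inv_equality[OF group_perm_group]) (simp_all add: permutes_inv permutes_inv_o)

fun letter_act :: "('x \<Rightarrow> 'p \<Rightarrow> 'p) \<Rightarrow> 'x \<times> bool \<Rightarrow> 'p \<Rightarrow> 'p" where
  "letter_act f (s, e) = (if e then f s else inv' (f s))"

text \<open>With \<open>foldr\<close> the last letter acts first, so concatenation of words becomes
  composition, as for \<open>word_val\<close>. The points on the path of \<open>w\<close> from
  \<open>p\<close> are thus the values at \<open>p\<close> of the suffixes of
  \<open>w\<close>.\<close>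

definition word_act :: "('x \<Rightarrow> 'p \<Rightarrow> 'p) \<Rightarrow> ('x \<times> bool) list \<Rightarrow> 'p \<Rightarrow> 'p" where
  "word_act f w p = foldr (letter_act f) w p"

lemma word_act_simps [simp]:
  "word_act f [] p = p"
  "word_act f (a # w) p = letter_act f a (word_act f w p)"
  "word_act f (v @ w) p = word_act f v (word_act f w p)"
  by (simp_all add: word_act_def)

lemma word_val_perm_group:
  assumes "\<And>s. s \<in> S \<Longrightarrow> f s permutes V" "w \<in> lists (S \<times> UNIV)"
  shows "word_val (perm_group V) f w = word_act f w"
  using assms(2)
proof (induction w)
  case (Cons a w)
  moreover have "letter_val (perm_group V) f a = letter_act f a"
    using assms(1) Cons.hyps(1) by (cases a) (auto simp: inv_perm_group)
  ultimately show ?case by (auto simp: fun_eq_iff)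
qed (auto simp: fun_eq_iff)

lemma word_act_cong:
  assumes "w \<in> lists (S \<times> UNIV)" "\<And>s. s \<in> S \<Longrightarrow> f s = g s"
  shows "word_act f w = word_act g w"
  using assms
proof (induction w)
  case (Cons a w)
  obtain s e where a: "a = (s, e)" by (cases a)
  have "f s = g s" using Cons.prems Cons.hyps(1) a by simp
  then show ?case using Cons.IH[OF Cons.prems] by (intro ext) (simp add: a)
qed (auto simp: fun_eq_iff)

text \<open>Every edge on the path of \<open>w\<close> from \<open>x\<close> has both ends in
  \<open>Y\<close>, and \<open>e\<close> carries such edges of \<open>f\<close> to edges of
  \<open>g\<close>.\<close>

lemma word_act_transfer:
  assumes w: "w \<in> lists (S \<times> UNIV)"
    and inj: "\<And>s. s \<in> S \<Longrightarrow> inj (g s)" and bij: "\<And>s. s \<in> S \<Longrightarrow> bij (f s)"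
    and eq: "\<And>s y. s \<in> S \<Longrightarrow> y \<in> Y \<Longrightarrow> f s y \<in> Y \<Longrightarrow> g s (e y) = e (f s y)"
    and stay: "\<And>v. suffix v w \<Longrightarrow> word_act f v x \<in> Y"
  shows "word_act g w (e x) = e (word_act f w x)"
  using w stay
proof (induction w)
  case (Cons a w)
  have IH: "word_act g w (e x) = e (word_act f w x)"
    using Cons.IH Cons.prems by (simp add: suffix_Cons)
  let ?y = "word_act f w x"
  have y: "?y \<in> Y" "letter_act f a ?y \<in> Y"
    using Cons.prems[of w] Cons.prems[of "a # w"] by (auto simp: suffix_Cons)
  obtain s b where a: "a = (s, b)" by (cases a)
  have s: "s \<in> S" using Cons.hyps a by auto
  show ?case
  proof (cases b)
    case True
    then show ?thesis using IH y eq[OF s] a by simp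
  next
    case False
    \<comment> \<open>An inverse letter runs backwards along the edge from
      \<open>inv' (f s) ?y\<close> to \<open>?y\<close>; injectivity of \<open>g s\<close> allows
      the image of this edge to be read backwards as well.\<close>
    have "f s (inv' (f s) ?y) = ?y" using bij[OF s] by (simp add: bij_is_surj surj_f_inv_f)
    then have "g s (e (inv' (f s) ?y)) = e ?y"
      using eq[OF s, of "inv' (f s) ?y"] y a False by simp
    then have "inv' (g s) (e ?y) = e (inv' (f s) ?y)"
      using inj[OF s] by (metis inv_f_f)
    then show ?thesis using IH a False by simp
  qed
qed simp

text \<open>Domain and image of the partial injection have complements of equal size in the finite
  set \<open>Y\<close>, and any bijection between these complements completes a permutation.\<close>

lemma partial_injection_extends:
  assumes "finite Y" "inj_on f Y"
  shows "\<exists>p. p permutes Y \<and> (\<forall>y\<in>Y. f y \<in> Y \<longrightarrow> p y = f y)"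
proof -
  define D where "D = {y \<in> Y. f y \<in> Y}"
  have D: "D \<subseteq> Y" "f ` D \<subseteq> Y" "inj_on f D"
    using assms(2) by (auto simp: D_def inj_on_def)
  have "card (f ` D) = card D" using D by (simp add: card_image)
  then have "card (Y - D) = card (Y - f ` D)"
    using assms(1) D by (simp add: card_Diff_subset finite_subset)
  then obtain h where h: "bij_betw h (Y - D) (Y - f ` D)"
    using assms(1) finite_same_card_bij[of "Y - D" "Y - f ` D"] by auto
  define p where "p y = (if y \<in> D then f y else if y \<in> Y then h y else y)" for y
  have "bij_betw p (D \<union> (Y - D)) (f ` D \<union> (Y - f ` D))"
  proof (rule bij_betw_combine)
    show "bij_betw p D (f ` D)" using D(3) by (auto simp: bij_betw_def p_def inj_on_def)
    show "bij_betw p (Y - D) (Y - f ` D)"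
      using h by (rule bij_betw_cong[THEN iffD1, rotated]) (auto simp: p_def)
  qed auto
  then have "bij_betw p Y Y" using D by (simp add: Un_absorb1)
  then have "p permutes Y" using D by (intro bij_imp_permutes) (auto simp: p_def)
  then show ?thesis by (intro exI[of _ p]) (auto simp: p_def D_def)
qed


section \<open>Reduced words\<close>

lemma reduced_words_append:
  "v @ w \<in> reduced_words S \<longleftrightarrow> v \<in> reduced_words S \<and> w \<in> reduced_words S \<and>
     (v = [] \<or> w = [] \<or> \<not> cancelling (last v) (hd w))"
  by (auto simp: reduced_words_def successively_append_iff)

lemma reduced_words_Cons:
  "a # w \<in> reduced_words S \<longleftrightarrow> a \<in> S \<times> UNIV \<and> w \<in> reduced_words S \<and>
     (w = [] \<or> \<not> cancelling a (hd w))"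
  by (auto simp: reduced_words_def successively_Cons)

lemma reduced_words_lists: "w \<in> reduced_words S \<Longrightarrow> w \<in> lists (S \<times> UNIV)"
  by (simp add: reduced_words_def)

lemma reduced_words_letters:
  assumes "w \<in> reduced_words S" "fst ` set w \<subseteq> T"
  shows "w \<in> reduced_words T"
proof -
  have "set w \<subseteq> T \<times> UNIV" using assms(2) by force
  then show ?thesis using assms(1) by (auto simp: reduced_words_def)
qed

lemma reduced_words_mono: "T \<subseteq> S \<Longrightarrow> reduced_words T \<subseteq> reduced_words S"
  by (auto simp: reduced_words_def)

text \<open>Cyclic reducedness is expressed by \<open>v @ v\<close> being reduced. If it fails for
  \<open>w\<close>, the outer letters are inverse to each other, and conjugation by the inverse of
  the first one strips both.\<close>

lemma (in group) conj_cyclically_reduced: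
  assumes f: "f \<in> S \<rightarrow> carrier G" and w: "w \<in> reduced_words S"
  shows "\<exists>c \<in> carrier G. \<exists>v. v @ v \<in> reduced_words S \<and>
           c \<otimes> word_val G f w \<otimes> inv c = word_val G f v"
  using w
proof (induction w rule: length_induct)
  case (1 w)
  note val = word_val_closed[OF f reduced_words_lists]
  show ?case
  proof (cases "w @ w \<in> reduced_words S")
    case True
    then show ?thesis using val[OF 1(2)] by (intro bexI[of _ \<one>] exI[of _ w]) auto
  next
    case False
    then have ne: "w \<noteq> []" and c: "cancelling (last w) (hd w)"
      using 1(2) by (auto simp: reduced_words_append)
    obtain a u where w: "w = a # u" using ne by (cases w) auto
    \<comment> \<open>A letter does not cancel itself, so \<open>w\<close> has at least two
      letters.\<close>
    have "u \<noteq> []" using c w by (auto simp: cancelling_def)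
    then obtain m b where u: "u = m @ [b]" by (cases u rule: rev_cases) auto
    have ba: "cancelling b a" using c w u by simp
    have red: "m \<in> reduced_words S" and ab: "a \<in> S \<times> UNIV" "b \<in> S \<times> UNIV"
      using 1(2) by (auto simp: w u reduced_words_append reduced_words_Cons)
    from 1(1)[rule_format, of m] red obtain d v where
      d: "d \<in> carrier G" "v @ v \<in> reduced_words S"
        "d \<otimes> word_val G f m \<otimes> inv d = word_val G f v"
      by (auto simp: w u)
    let ?a = "letter_val G f a" and ?b = "letter_val G f b" and ?m = "word_val G f m"
    have cl: "?a \<in> carrier G" "?b \<in> carrier G" "?m \<in> carrier G"
      using letter_val_closed[OF f] ab val[OF red] by auto
    have b: "?b = inv ?a"
      using ba funcset_mem[OF f] ab by (cases a; cases b) (auto simp: cancelling_def)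
    have wv: "word_val G f w = ?a \<otimes> ?m \<otimes> inv ?a"
      using word_val_append[OF f, of m "[b]"] reduced_words_lists[OF red] ab cl
      by (simp add: w u b m_assoc)
    have "(d \<otimes> inv ?a) \<otimes> word_val G f w \<otimes> inv (d \<otimes> inv ?a) = d \<otimes> ?m \<otimes> inv d"
      using cl d(1) by (simp add: wv inv_mult_group m_assoc inv_solve_left' flip: m_assoc)
         (simp add: m_assoc)
    then show ?thesis using d cl by (intro bexI[of _ "d \<otimes> inv ?a"] exI[of _ v]) auto
  qed
qed


section \<open>Finite completions of coset graphs\<close>

text \<open>The edges of the Schreier coset graph. Sets that are not cosets are left fixed, so that
  group elements act by bijections of the whole type and \<open>inv'\<close> yields the inverse
  edges.\<close>

definition coset_act :: "('a, 'b) monoid_scheme \<Rightarrow> 'a set \<Rightarrow> 'a \<Rightarrow> 'a set \<Rightarrow> 'a set" where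
  "coset_act G K s C = (if \<exists>g \<in> carrier G. C = g <#\<^bsub>G\<^esub> K then s <#\<^bsub>G\<^esub> C else C)"

context group
begin

lemma coset_act_coset:
  assumes "subgroup K G" "s \<in> carrier G" "g \<in> carrier G"
  shows "coset_act G K s (g <# K) = (s \<otimes> g) <# K"
  using assms by (auto simp: coset_act_def lcos_m_assoc subgroup.subset)

lemma coset_act_inverse:
  assumes K: "subgroup K G" and s: "s \<in> carrier G"
  shows "coset_act G K (inv s) (coset_act G K s C) = C"
proof (cases "\<exists>g \<in> carrier G. C = g <# K")
  case True
  then show ?thesis using K s by (auto simp: coset_act_coset simp flip: m_assoc)
qed (simp add: coset_act_def)

lemma coset_act_o_inverse:
  assumes "subgroup K G" "s \<in> carrier G"
  shows "coset_act G K (inv s) \<circ> coset_act G K s = id" "coset_act G K s \<circ> coset_act G K (inv s) = id"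
  using coset_act_inverse[OF assms] coset_act_inverse[OF assms(1), of "inv s"] assms(2)
  by (auto simp: fun_eq_iff)

lemma bij_coset_act:
  assumes "subgroup K G" "s \<in> carrier G"
  shows "bij (coset_act G K s)"
  using coset_act_o_inverse[OF assms] by (rule o_bij)

lemma inv_coset_act:
  assumes "subgroup K G" "s \<in> carrier G"
  shows "inv' (coset_act G K s) = coset_act G K (inv s)"
  using coset_act_o_inverse[OF assms] by (intro inv_unique_comp) auto

lemma word_act_coset:
  assumes K: "subgroup K G" and S: "S \<subseteq> carrier G" and w: "w \<in> lists (S \<times> UNIV)"
    and g: "g \<in> carrier G"
  shows "word_act (coset_act G K) w (g <# K) = (word_val G (\<lambda>x. x) w \<otimes> g) <# K"
  using w
proof (induction w)
  case (Cons a w)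
  have i: "(\<lambda>x. x) \<in> S \<rightarrow> carrier G" using S by auto
  have w: "word_val G (\<lambda>x. x) w \<in> carrier G" using word_val_closed[OF i] Cons by auto
  show ?case
    using Cons S w g K
    by (cases a) (auto simp: coset_act_coset inv_coset_act m_assoc subset_iff)
qed (use g in simp)

text \<open>The stabiliser of a coset is the conjugate of \<open>K\<close> by a representative. This
  turns fixed cosets into conjugates lying in \<open>K\<close>.\<close>

lemma coset_eq_iff:
  assumes "subgroup K G" "h \<in> carrier G" "g \<in> carrier G"
  shows "(h \<otimes> g) <# K = g <# K \<longleftrightarrow> inv g \<otimes> h \<otimes> g \<in> K"
proof
  assume "(h \<otimes> g) <# K = g <# K"
  moreover have "h \<otimes> g \<in> (h \<otimes> g) <# K"
    using assms subgroup.one_closed[OF assms(1)] by (force simp: l_coset_def)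
  ultimately obtain k where k: "k \<in> K" "h \<otimes> g = g \<otimes> k" by (auto simp: l_coset_def)
  then have "inv g \<otimes> h \<otimes> g = k"
    using assms subgroup.mem_carrier[OF assms(1)] by (simp add: m_assoc inv_solve_left')
  then show "inv g \<otimes> h \<otimes> g \<in> K" using k by simp
next
  assume k: "inv g \<otimes> h \<otimes> g \<in> K"
  have "h \<otimes> g \<in> g <# K" using k assms
    by (auto simp: l_coset_def m_assoc intro!: bexI[of _ "inv g \<otimes> h \<otimes> g"] simp flip: m_assoc)
  then show "(h \<otimes> g) <# K = g <# K"
    using l_repr_independence[of "h \<otimes> g" g K] assms by simp
qed

lemma coset_eq_self_iff:
  assumes "subgroup K G" "h \<in> carrier G"
  shows "h <# K = K \<longleftrightarrow> h \<in> K"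
  using coset_eq_iff[OF assms one_closed] assms by (simp add: lcos_mult_one subgroup.subset)

end

section \<open>Grafting a finite action without short relations\<close>

text \<open>To be instantiated with the coset action \<open>f\<close>, a completion
  \<open>\<pi>\<close> of its restriction to \<open>Y\<close>, and a finite action
  \<open>\<rho>\<close> whose graph has girth above \<open>n\<close>, which is what
  \<open>free\<close> expresses.\<close>

locale grafting =
  fixes f \<pi> :: "'x \<Rightarrow> 'p \<Rightarrow> 'p" and \<rho> :: "'x \<Rightarrow> 'z \<Rightarrow> 'z"
    and S :: "'x set" and Y :: "'p set" and Z :: "'z set" and z0 :: 'z and n :: nat
  assumes finite: "finite S" "finite Y" "finite Z"
    and z0: "z0 \<in> Z"
    and bij_f: "s \<in> S \<Longrightarrow> bij (f s)"
    and \<pi>: "s \<in> S \<Longrightarrow> \<pi> s permutes Y"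
    and \<pi>_extends: "s \<in> S \<Longrightarrow> y \<in> Y \<Longrightarrow> f s y \<in> Y \<Longrightarrow> \<pi> s y = f s y"
    and \<rho>: "s \<in> S \<Longrightarrow> \<rho> s permutes Z"
    and free: "w \<in> reduced_words S \<Longrightarrow> w \<noteq> [] \<Longrightarrow> length w \<le> n \<Longrightarrow> z \<in> Z \<Longrightarrow>
      word_act \<rho> w z \<noteq> z"
begin

text \<open>The copies of \<open>Z\<close> are indexed by potential edges: the copy
  \<open>(s, y)\<close> is joined to \<open>Y\<close> exactly when \<open>leaves s y\<close>
  holds.\<close>

definition points :: "('p + ('x \<times> 'p) \<times> 'z) set" where
  "points = Inl ` Y \<union> Inr ` ((S \<times> Y) \<times> Z)"

definition leaves :: "'x \<Rightarrow> 'p \<Rightarrow> bool" where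
  "leaves s y \<longleftrightarrow> s \<in> S \<and> y \<in> Y \<and> f s y \<notin> Y"

fun move :: "'x \<Rightarrow> 'p + ('x \<times> 'p) \<times> 'z \<Rightarrow> 'p + ('x \<times> 'p) \<times> 'z" where
  "move s (Inl y) = Inl (\<pi> s y)"
| "move s (Inr (i, z)) = Inr (i, if i \<in> S \<times> Y then \<rho> s z else z)"

text \<open>Exchanging the starting points of two edges before \<open>move\<close> redirects both of
  them. As \<open>swap s\<close> is an involution, \<open>graft s\<close> is a permutation whose
  inverse undoes \<open>move s\<close> and then swaps.\<close>

fun swap :: "'x \<Rightarrow> 'p + ('x \<times> 'p) \<times> 'z \<Rightarrow> 'p + ('x \<times> 'p) \<times> 'z" where
  "swap s (Inl y) = (if leaves s y then Inr ((s, y), z0) else Inl y)"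
| "swap s (Inr ((t, y), z)) =
    (if t = s \<and> z = z0 \<and> leaves s y then Inl y else Inr ((t, y), z))"

text \<open>
  An edge that leads out of \<open>Y\<close> is redirected into its own copy of \<open>Z\<close>, where it enters at
  \<open>\<rho> s z0\<close>; in exchange the edge from \<open>z0\<close> to \<open>\<rho> s z0\<close> of that copy is redirected into \<open>Y\<close>.
\<close>

definition graft :: "'x \<Rightarrow> 'p + ('x \<times> 'p) \<times> 'z \<Rightarrow> 'p + ('x \<times> 'p) \<times> 'z" where
  "graft s = move s \<circ> swap s"

lemma graft_apply:
  "graft s (Inl y) = move s (swap s (Inl y))"
  "graft s (Inr (i, z)) = move s (swap s (Inr (i, z)))"
  by (simp_all add: graft_def)

lemma finite_points: "finite points"
  using finite by (simp add: points_def)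

lemma swap_swap: "swap s (swap s v) = v"
  by (cases "(s, v)" rule: swap.cases) auto

lemma swap_permutes: "swap s permutes points"
proof (rule inj_imp_permutes[OF _ finite_points])
  show "inj_on (swap s) points" by (metis inj_onI swap_swap)
  show "swap s v \<in> points" if "v \<in> points" for v
    using that z0 by (cases "(s, v)" rule: swap.cases) (auto simp: points_def leaves_def)
  show "swap s v = v" if "v \<notin> points" for v
    using that z0 by (cases "(s, v)" rule: swap.cases) (auto simp: points_def leaves_def)
qed

lemma move_permutes:
  assumes s: "s \<in> S"
  shows "move s permutes points"
proof (rule inj_imp_permutes[OF _ finite_points])
  show "inj_on (move s) points"
    using permutes_inj[OF \<pi>[OF s]] permutes_inj[OF \<rho>[OF s]]
    by (auto simp: points_def inj_on_def)
  show "move s v \<in> points" if "v \<in> points" for v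
    using that permutes_in_image[OF \<pi>[OF s]] permutes_in_image[OF \<rho>[OF s]]
    by (cases "(s, v)" rule: move.cases) (auto simp: points_def)
  show "move s v = v" if "v \<notin> points" for v
    using that permutes_not_in[OF \<pi>[OF s]] permutes_not_in[OF \<rho>[OF s]]
    by (cases "(s, v)" rule: move.cases) (auto simp: points_def)
qed

lemma graft_permutes: "s \<in> S \<Longrightarrow> graft s permutes points"
  unfolding graft_def by (intro permutes_compose swap_permutes move_permutes)

lemma inv_graft:
  assumes s: "s \<in> S"
  shows "inv' (graft s) (Inl y) = swap s (Inl (inv' (\<pi> s) y))"
    and "i \<in> S \<times> Y \<Longrightarrow> inv' (graft s) (Inr (i, z)) = swap s (Inr (i, inv' (\<rho> s) z))"
  unfolding permutes_inv_eq[OF graft_permutes[OF s]]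
  by (simp_all add: graft_def swap_swap permutes_inverses[OF \<pi>[OF s]]
      permutes_inverses[OF \<rho>[OF s]] del: swap.simps)

section \<open>Paths in the graft\<close>

lemma word_act_points:
  "w \<in> lists (S \<times> UNIV) \<Longrightarrow> v \<in> points \<Longrightarrow> word_act graft w v \<in> points"
proof (induction w)
  case (Cons a w)
  then show ?case
    by (cases a) (auto simp: permutes_in_image graft_permutes permutes_inv)
qed simp

text \<open>An edge of \<open>f\<close> with both ends in \<open>Y\<close> is neither redirected nor
  altered by \<open>\<pi>\<close>. This will make the generators of \<open>K\<close> fix the base
  point of the graft.\<close>

lemma word_act_agrees:
  assumes "w \<in> lists (S \<times> UNIV)" "\<And>v. suffix v w \<Longrightarrow> word_act f v x \<in> Y"
  shows "word_act graft w (Inl x) = Inl (word_act f w x)"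
proof (rule word_act_transfer[where e = Inl, OF assms(1)])
  show "inj (graft s)" if "s \<in> S" for s
    using graft_permutes[OF that] by (rule permutes_inj)
qed (use assms(2) in \<open>auto simp: bij_f graft_apply leaves_def \<pi>_extends\<close>)

text \<open>
  The point reached from \<open>Y\<close> by \<open>w\<close> lies in a copy of \<open>Z\<close>, where \<open>u\<close> is the part of \<open>w\<close> read
  since \<open>z0\<close>. If the copy was entered against the direction of the redirected edge, that is at
  \<open>z0\<close>, then the entering letter is not part of \<open>u\<close>.
\<close>

definition trapped :: "('x \<times> bool) list \<Rightarrow> 'p + ('x \<times> 'p) \<times> 'z \<Rightarrow> bool" where
  "trapped w v \<longleftrightarrow> (\<exists>s y u r. (s, y) \<in> S \<times> Y \<and> w = u @ r \<and> v = Inr ((s, y), word_act \<rho> u z0) \<and>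
     (u = [] \<longrightarrow> r \<noteq> [] \<and> hd r = (s, False)))"

text \<open>The copy can be left only through its cut edge. Positively this edge is used from
  \<open>z0\<close>, so \<open>u\<close> would fix \<open>z0\<close>; negatively it is reached by
  arriving at \<open>z0\<close>, so \<open>a # u\<close> would fix \<open>z0\<close>. Both words are
  reduced and short.\<close>

lemma trapped_Cons:
  assumes t: "trapped w v" and red: "a # w \<in> reduced_words S" and len: "length (a # w) \<le> n"
  shows "trapped (a # w) (letter_act graft a v)"
proof -
  obtain s y u r where sy: "(s, y) \<in> S \<times> Y" and w: "w = u @ r"
    and v: "v = Inr ((s, y), word_act \<rho> u z0)" and u: "u = [] \<longrightarrow> r \<noteq> [] \<and> hd r = (s, False)"
    using t by (auto simp: trapped_def)
  obtain t e where a: "a = (t, e)" by (cases a)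
  have tS: "t \<in> S" using red a by (auto simp: reduced_words_Cons)
  have "(a # u) @ r \<in> reduced_words S" using red w by simp
  then have au: "a # u \<in> reduced_words S" unfolding reduced_words_append by simp
  then have ru: "u \<in> reduced_words S" by (simp add: reduced_words_Cons)
  have len_u: "length (a # u) \<le> n" using len w by simp
  let ?z = "word_act \<rho> u z0"
  have "letter_act graft a v = Inr ((s, y), letter_act \<rho> a ?z)"
  proof (cases e)
    case True
    have "\<not> (s = t \<and> ?z = z0)"
    proof
      assume *: "s = t \<and> ?z = z0"
      \<comment> \<open>With \<open>u\<close> empty, the copy was just entered by
        \<open>(s, False)\<close>, which the letter \<open>a\<close> would cancel.\<close>
      then have "u = []" using free[OF ru _ _ z0] len_u by auto
      then show False
        using u red * True a w by (auto simp: reduced_words_Cons cancelling_def)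
    qed
    then show ?thesis using sy True by (auto simp: v a graft_apply)
  next
    case False
    have "inv' (\<rho> t) ?z \<noteq> z0"
      using free[OF au _ len_u z0] a False by simp
    then show ?thesis using sy False tS by (simp add: v a inv_graft)
  qed
  then show ?thesis
    using sy w unfolding trapped_def
    by (intro exI[of _ s] exI[of _ y] exI[of _ "a # u"] exI[of _ r]) auto
qed

lemma trapped_append:
  assumes "trapped w v" "u @ w \<in> reduced_words S" "length (u @ w) \<le> n"
  shows "trapped (u @ w) (word_act graft u v)"
  using assms(2,3)
proof (induction u)
  case Nil
  then show ?case using assms(1) by simp
next
  case (Cons a u)
  then have "trapped (u @ w) (word_act graft u v)" by (auto simp: reduced_words_Cons)
  then show ?case using trapped_Cons[of "u @ w" _ a] Cons.prems by simp
qed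

text \<open>Inside \<open>Y\<close> the graft follows \<open>f\<close> until a letter uses a
  redirected edge. From then on \<open>trapped_Cons\<close> applies.\<close>

lemma stays_or_trapped:
  assumes y: "y \<in> Y" and red: "w \<in> reduced_words S" and len: "length w \<le> n"
  shows "word_act graft w (Inl y) = Inl (word_act f w y) \<and> word_act f w y \<in> Y \<or>
    trapped w (word_act graft w (Inl y))"
  using red len
proof (induction w)
  case Nil
  then show ?case using y by simp
next
  case (Cons a w)
  have red: "w \<in> reduced_words S" using Cons.prems(1) by (simp add: reduced_words_Cons)
  have "length w \<le> n" using Cons.prems(2) by simp
  from Cons.IH[OF red this] show ?case
  proof (elim disjE conjE)
    assume "trapped w (word_act graft w (Inl y))"
    then show ?thesis using trapped_Cons Cons.prems by simp
  next
    assume eq: "word_act graft w (Inl y) = Inl (word_act f w y)" and inY: "word_act f w y \<in> Y"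
    let ?y = "word_act f w y"
    obtain s e where a: "a = (s, e)" by (cases a)
    have s: "s \<in> S" using Cons.prems(1) a by (simp add: reduced_words_Cons)
    show ?thesis
    proof (cases e)
      case True
      show ?thesis
      proof (cases "f s ?y \<in> Y")
        case inside: True
        then have "\<not> leaves s ?y" by (simp add: leaves_def)
        then show ?thesis using inside eq inY True s by (simp add: a graft_apply \<pi>_extends)
      next
        case False
        then have "leaves s ?y" using s inY by (simp add: leaves_def)
        \<comment> \<open>The copy \<open>(s, ?y)\<close> is entered at \<open>\<rho> s z0\<close>,
          so the entering letter already counts as read from \<open>z0\<close>.\<close>
        then have "trapped (a # w) (letter_act graft a (Inl ?y))"
          using s inY True unfolding trapped_def
          by (intro exI[of _ s] exI[of _ ?y] exI[of _ "[a]"] exI[of _ w]) (simp add: a graft_apply)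
        then show ?thesis using eq by simp
      qed
    next
      case False
      let ?x = "inv' (\<pi> s) ?y"
      have x: "?x \<in> Y" using inY permutes_in_image[OF permutes_inv[OF \<pi>[OF s]]] by simp
      show ?thesis
      proof (cases "f s ?x \<in> Y")
        case inside: True
        \<comment> \<open>\<open>?x\<close> is the predecessor of \<open>?y\<close> under
          \<open>\<pi>\<close>; it is the predecessor under \<open>f\<close> once
          \<open>f s ?x\<close> lies in \<open>Y\<close>.\<close>
        then have "f s ?x = ?y"
          using \<pi>_extends[OF s x] permutes_inverses[OF \<pi>[OF s]] by simp
        then have "inv' (f s) ?y = ?x"
          using bij_f[OF s] by (metis bij_inv_eq_iff)
        moreover have "\<not> leaves s ?x" using inside by (simp add: leaves_def)
        ultimately show ?thesis using eq x False s by (simp add: a inv_graft)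
      next
        case outside: False
        then have "leaves s ?x" using s x by (simp add: leaves_def)
        \<comment> \<open>The edge of \<open>\<pi>\<close> from \<open>?x\<close> to
          \<open>?y\<close> now starts at \<open>z0\<close> in the copy \<open>(s, ?x)\<close>. Read
          backwards it ends at \<open>z0\<close>, so nothing has yet been read inside the
          copy.\<close>
        then have "trapped (a # w) (letter_act graft a (Inl ?y))"
          using s x False unfolding trapped_def
          by (intro exI[of _ s] exI[of _ ?x] exI[of _ "[]"] exI[of _ "a # w"])
             (simp add: a inv_graft)
        then show ?thesis using eq by simp
      qed
    qed
  qed
qed

text \<open>A trapped point lies in a copy of \<open>Z\<close>, so a path ending at
  \<open>Inl y\<close> is not trapped at its end.\<close>

lemma fixed_in_Y:
  assumes "y \<in> Y" "w \<in> reduced_words S" "length w \<le> n" "word_act graft w (Inl y) = Inl y"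
  shows "word_act f w y = y"
  using stays_or_trapped[OF assms(1-3)] assms(4) by (auto simp: trapped_def)

text \<open>Every redirected edge has an end in \<open>Y\<close>, so a path avoiding
  \<open>Y\<close> uses only edges of its own copy.\<close>

lemma avoids_Y_in_copy:
  assumes "w \<in> lists (S \<times> UNIV)" "i \<in> S \<times> Y"
    and "\<And>v. suffix v w \<Longrightarrow> word_act graft v (Inr (i, z)) \<notin> range Inl"
  shows "word_act graft w (Inr (i, z)) = Inr (i, word_act \<rho> w z)"
  using assms(1,3)
proof (induction w)
  case (Cons a w)
  then have IH: "word_act graft w (Inr (i, z)) = Inr (i, word_act \<rho> w z)"
    by (simp add: suffix_Cons)
  obtain s e where a: "a = (s, e)" by (cases a)
  have s: "s \<in> S" using Cons.hyps a by auto
  have stays: "letter_act graft a (Inr (i, word_act \<rho> w z)) \<notin> range Inl"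
    using Cons.prems[of "a # w"] IH by simp
  obtain t y where i: "i = (t, y)" by (cases i)
  show ?case
    using IH stays assms(2) s
    by (cases e) (auto simp: a i graft_apply inv_graft split: if_splits)
qed simp

text \<open>
  The closed path of a cyclically reduced word may be read from any of its points, in
  particular from a point in \<open>Y\<close>; a reduced path that starts in \<open>Y\<close> and leaves it is not closed.
\<close>

lemma cyclically_reduced_fixed_in_Y:
  assumes w: "w @ w \<in> reduced_words S" "w \<noteq> []" "length w \<le> n"
    and v: "v \<in> points" "word_act graft w v = v"
  shows "v \<in> Inl ` Y"
proof (rule ccontr)
  assume "v \<notin> Inl ` Y"
  then obtain i z where v': "v = Inr (i, z)" "i \<in> S \<times> Y" "z \<in> Z"
    using v(1) unfolding points_def by blast
  have red: "w \<in> reduced_words S" using w(1) by (simp add: reduced_words_append)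
  show False
  proof (cases "\<exists>u. suffix u w \<and> word_act graft u v \<in> range Inl")
    case False
    then have "word_act graft w v = Inr (i, word_act \<rho> w z)"
      using avoids_Y_in_copy[OF reduced_words_lists[OF red] v'(2), of z] v'(1) by auto
    then show False using free[OF red w(2,3) v'(3)] v(2) v'(1) by simp
  next
    case True
    then obtain w1 w2 y where w12: "w = w2 @ w1" "word_act graft w1 v = Inl y"
      by (auto simp: suffix_def)
    have w1: "w1 \<in> lists (S \<times> UNIV)" using reduced_words_lists[OF red] w12(1) by simp
    have y: "y \<in> Y" using word_act_points[OF w1 v(1)] w12(2) by (auto simp: points_def)
    have w2: "word_act graft w2 (Inl y) = v" using v(2) w12 by simp
    \<comment> \<open>The rotation \<open>w1 @ w2\<close> is a factor of \<open>w @ w\<close>. Read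
      from \<open>y\<close>, it passes through \<open>v\<close> outside \<open>Y\<close> and returns
      to \<open>y\<close>.\<close>
    have "w1 @ w2 \<in> reduced_words S" "w2 \<in> reduced_words S"
      using w(1) unfolding w12(1) by (auto simp: reduced_words_append)
    then have "trapped (w1 @ w2) (word_act graft w1 v)"
      using stays_or_trapped[OF y, of w2] trapped_append[of w2 v w1] w(3) w2 v'(1) w12(1) by auto
    then show False using w12(2) by (auto simp: trapped_def)
  qed
qed

end


section \<open>Finite actions of a free group\<close>

context group
begin

section \<open>Generators, conjugation and actions defined on a basis\<close>

lemma generate_fixes:
  assumes hom: "\<phi> \<in> hom G (perm_group V)" and A: "A \<subseteq> carrier G"
    and fixes_A: "\<And>a. a \<in> A \<Longrightarrow> \<phi> a x = x" and k: "k \<in> generate G A"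
  shows "\<phi> k x = x"
proof -
  interpret h: group_hom G "perm_group V" \<phi>
    using hom group_perm_group by (auto simp: group_hom_def group_hom_axioms_def)
  show ?thesis using k
  proof (induction k rule: generate.induct)
    case one
    then show ?case using h.hom_one by simp
  next
    case (inv a)
    then have a: "a \<in> carrier G" using A by auto
    then have "\<phi> (inv a) = inv' (\<phi> a)" and p: "\<phi> a permutes V"
      using h.hom_closed by (auto simp: inv_perm_group)
    then show ?case using fixes_A[OF inv] by (simp add: permutes_inv_eq)
  next
    case (eng a b)
    then show ?case
      using generate_in_carrier[OF A] h.hom_mult[of a b] by (simp add: o_def)
  qed (use fixes_A in auto)
qed

lemma inv_mult_cancel:
  assumes "x \<in> carrier G" "y \<in> carrier G"
  shows "inv x \<otimes> (x \<otimes> y) = y" "x \<otimes> (inv x \<otimes> y) = y"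
  using assms by (simp_all flip: m_assoc)

lemma generate_conj_subset:
  assumes B: "B \<subseteq> carrier G" and K: "subgroup K G" and g: "g \<in> carrier G"
    and conj: "\<And>b. b \<in> B \<Longrightarrow> g \<otimes> b \<otimes> inv g \<in> K" and h: "h \<in> generate G B"
  shows "g \<otimes> h \<otimes> inv g \<in> K"
  using h
proof (induction h rule: generate.induct)
  case one
  then show ?case using g K by (simp add: subgroup.one_closed)
next
  case (inv b)
  have "g \<otimes> inv b \<otimes> inv g = inv (g \<otimes> b \<otimes> inv g)"
    using inv B g by (auto simp: inv_mult_group m_assoc subset_iff)
  then show ?case using conj[OF inv] K by (simp add: subgroup.m_inv_closed)
next
  case (eng a b)
  have "g \<otimes> (a \<otimes> b) \<otimes> inv g = (g \<otimes> a \<otimes> inv g) \<otimes> (g \<otimes> b \<otimes> inv g)"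
    using generate_in_carrier[OF B] eng.hyps g
    by (simp add: m_assoc inv_mult_cancel)
  then show ?case using eng K by (simp add: subgroup.m_closed)
qed (rule conj)

lemma finite_reduced_words_exist:
  assumes S: "free_basis G S" and B: "finite B" "B \<subseteq> carrier G"
  obtains W where "finite W" "W \<subseteq> reduced_words S" "word_val G (\<lambda>x. x) ` W = B"
proof -
  have "B \<subseteq> word_val G (\<lambda>x. x) ` reduced_words S"
    using S B(2) by (auto simp: free_basis_def bij_betw_def)
  then show thesis using finite_subset_image[OF B(1)] that by metis
qed

lemma free_basis_perm_hom:
  assumes S: "free_basis G S" and \<tau>: "\<And>s. s \<in> S \<Longrightarrow> \<tau> s permutes V"
  obtains \<phi> where "\<phi> \<in> hom G (perm_group V)"
    "\<forall>w \<in> lists (S \<times> UNIV). \<phi> (word_val G (\<lambda>x. x) w) = word_act \<tau> w"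
proof -
  have i: "(\<lambda>x. x) \<in> S \<rightarrow> carrier G" using S by (auto simp: free_basis_def)
  obtain \<phi> where \<phi>: "\<phi> \<in> hom G (perm_group V)" "\<forall>x\<in>S. \<phi> x = \<tau> x"
    using free_basis_universal[OF is_group S group_perm_group, of \<tau> V] \<tau> by auto
  have "\<phi> (word_val G (\<lambda>x. x) w) = word_act \<tau> w" if w: "w \<in> lists (S \<times> UNIV)" for w
  proof -
    have "\<phi> (word_val G (\<lambda>x. x) w) = word_val (perm_group V) (\<phi> \<circ> (\<lambda>x. x)) w"
      by (rule hom_word_val[OF is_group group_perm_group \<phi>(1) i w])
    also have "\<dots> = word_val (perm_group V) \<tau> w"
      using \<phi>(2) by (intro word_val_cong[OF w]) simp
    also have "\<dots> = word_act \<tau> w" by (rule word_val_perm_group[OF \<tau> w])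
    finally show ?thesis .
  qed
  with \<phi>(1) that show thesis by blast
qed

section \<open>Separability of finitely generated subgroups\<close>

text \<open>\<open>Y\<close> consists of the cosets visited by the paths of \<open>W\<close> from
  \<open>K\<close>. Each generator induces a partial injection on this finite set, which extends to
  a permutation.\<close>

lemma finite_coset_completion:
  assumes K: "subgroup K G" and S: "S \<subseteq> carrier G"
    and W: "finite W" "W \<subseteq> lists (S \<times> UNIV)"
  obtains Y \<pi> where "finite Y" "K \<in> Y" "Y \<subseteq> (\<lambda>g. g <# K) ` carrier G"
    "\<forall>s\<in>S. \<pi> s permutes Y"
    "\<forall>s\<in>S. \<forall>y\<in>Y. coset_act G K s y \<in> Y \<longrightarrow> \<pi> s y = coset_act G K s y"
    "\<forall>w\<in>W. \<forall>v. suffix v w \<longrightarrow> word_act (coset_act G K) v K \<in> Y"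
proof -
  \<comment> \<open>The empty word puts the base point \<open>K\<close> into \<open>Y\<close> even
    when \<open>W\<close> is empty.\<close>
  define U where "U = insert [] (\<Union>w\<in>W. set (suffixes w))"
  define Y where "Y = (\<lambda>v. word_val G (\<lambda>x. x) v <# K) ` U"
  have i: "(\<lambda>x. x) \<in> S \<rightarrow> carrier G" using S by auto
  have U: "U \<subseteq> lists (S \<times> UNIV)"
    using W(2) by (fastforce simp: U_def suffix_def)
  have K1: "\<one> <# K = K" using K by (simp add: lcos_mult_one subgroup.subset)
  have fin: "finite Y" using W(1) by (simp add: Y_def U_def)
  have "\<exists>p. p permutes Y \<and>
      (\<forall>y\<in>Y. coset_act G K s y \<in> Y \<longrightarrow> p y = coset_act G K s y)" if "s \<in> S" for s
    using bij_is_inj[OF bij_coset_act[OF K, of s]] that S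
    by (intro partial_injection_extends[OF fin]) (auto intro: inj_on_subset)
  then obtain \<pi> where \<pi>: "\<forall>s\<in>S. \<pi> s permutes Y"
    "\<forall>s\<in>S. \<forall>y\<in>Y. coset_act G K s y \<in> Y \<longrightarrow> \<pi> s y = coset_act G K s y"
    by metis
  show thesis
  proof (rule that[OF fin _ _ \<pi>])
    show "K \<in> Y" using K1 by (auto simp: Y_def U_def)
    show "Y \<subseteq> (\<lambda>g. g <# K) ` carrier G" using word_val_closed[OF i] U by (auto simp: Y_def)
    show "\<forall>w\<in>W. \<forall>v. suffix v w \<longrightarrow> word_act (coset_act G K) v K \<in> Y"
    proof (intro ballI allI impI)
      fix w v assume that: "w \<in> W" "suffix v w"
      have v: "v \<in> U" using that by (auto simp: U_def)
      then have vl: "v \<in> lists (S \<times> UNIV)" using U by blast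
      have "word_act (coset_act G K) v K = word_val G (\<lambda>x. x) v <# K"
        using word_act_coset[OF K S vl one_closed] word_val_closed[OF i vl] K1 by simp
      then show "word_act (coset_act G K) v K \<in> Y" using v by (auto simp: Y_def)
    qed
  qed
qed

text \<open>Marshall Hall's argument: when the completion contains the paths of \<open>A\<close> and
  \<open>B\<close>, each element \<open>c\<close> of these sets sends the base point
  \<open>K\<close> to its true coset \<open>c <# K\<close>, which equals \<open>K\<close> only if
  \<open>c\<close> lies in \<open>K\<close>.\<close>

lemma finitely_generated_separable:
  assumes S: "free_basis G S" and A: "finite A" "A \<subseteq> carrier G"
    and B: "finite B" "B \<subseteq> carrier G"
  obtains Y :: "'a set set" and \<phi> x where "finite Y" "\<phi> \<in> hom G (perm_group Y)" "x \<in> Y"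
    "\<And>k. k \<in> generate G A \<Longrightarrow> \<phi> k x = x"
    "\<And>b. b \<in> B \<Longrightarrow> b \<notin> generate G A \<Longrightarrow> \<phi> b x \<noteq> x"
proof -
  let ?K = "generate G A"
  have K: "subgroup ?K G" by (rule generate_is_subgroup[OF A(2)])
  have S': "S \<subseteq> carrier G" using S by (simp add: free_basis_def)
  obtain W where W: "finite W" "W \<subseteq> reduced_words S" "word_val G (\<lambda>x. x) ` W = A \<union> B"
    using finite_reduced_words_exist[OF S, of "A \<union> B"] A B by auto
  have Wl: "W \<subseteq> lists (S \<times> UNIV)" using W(2) by (auto simp: reduced_words_def)
  obtain Y \<pi> where Y: "finite Y" "?K \<in> Y" "Y \<subseteq> (\<lambda>g. g <# ?K) ` carrier G"
    and \<pi>: "\<forall>s\<in>S. \<pi> s permutes Y"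
    "\<forall>s\<in>S. \<forall>y\<in>Y. coset_act G ?K s y \<in> Y \<longrightarrow> \<pi> s y = coset_act G ?K s y"
    and stay: "\<forall>w\<in>W. \<forall>v. suffix v w \<longrightarrow> word_act (coset_act G ?K) v ?K \<in> Y"
    by (rule finite_coset_completion[OF K S' W(1) Wl]) blast
  obtain \<phi> where hom: "\<phi> \<in> hom G (perm_group Y)"
    and \<phi>: "\<forall>w \<in> lists (S \<times> UNIV). \<phi> (word_val G (\<lambda>x. x) w) = word_act \<pi> w"
    by (rule free_basis_perm_hom[OF S \<pi>(1)[rule_format]]) blast
  have act: "\<phi> c ?K = c <# ?K" if "c \<in> A \<union> B" for c
  proof -
    have "c \<in> word_val G (\<lambda>x. x) ` W" using that by (simp only: W(3))
    then obtain w where w: "w \<in> W" "c = word_val G (\<lambda>x. x) w" by (elim imageE)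
    then have wl: "w \<in> lists (S \<times> UNIV)" using Wl by blast
    have "word_act \<pi> w ?K = word_act (coset_act G ?K) w ?K"
    proof (rule word_act_transfer[where e = "\<lambda>y. y" and Y = Y, OF wl])
      show "inj (\<pi> s)" if "s \<in> S" for s using \<pi>(1) that permutes_inj by blast
      show "bij (coset_act G ?K s)" if "s \<in> S" for s using bij_coset_act[OF K] that S' by blast
    qed (use \<pi>(2) stay w(1) in blast)+
    also have "\<dots> = c <# ?K"
      using word_act_coset[OF K S' wl one_closed] that A(2) B(2) w K
      by (auto simp: lcos_mult_one subgroup.subset)
    finally show ?thesis using \<phi>[rule_format, OF wl] w by simp
  qed
  have fix_iff: "\<phi> c ?K = ?K \<longleftrightarrow> c \<in> ?K" if "c \<in> A \<union> B" for c
    using coset_eq_self_iff[OF K] act[OF that] that A(2) B(2) by auto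
  show thesis
  proof (rule that[OF Y(1) hom Y(2)])
    have "\<phi> a ?K = ?K" if "a \<in> A" for a
      using fix_iff[of a] generate.incl[OF that, of G] that by simp
    then show "\<phi> k ?K = ?K" if "k \<in> ?K" for k
      using generate_fixes[OF hom A(2) _ that] by simp
    show "\<phi> b ?K \<noteq> ?K" if "b \<in> B" "b \<notin> ?K" for b
      using fix_iff[of b] that by simp
  qed
qed

text \<open>Conjugation by \<open>c\<close> induces an injective self-map of the finite image of the
  subgroup, hence a surjective one. An element \<open>inv c \<otimes> g \<otimes> c\<close> outside
  the subgroup would therefore have its image inside that of the subgroup, against
  separability.\<close>

lemma finitely_generated_conj_subset_eq:
  assumes S: "free_basis G S" and A: "finite A" "A \<subseteq> carrier G" and c: "c \<in> carrier G"
    and sub: "\<And>h. h \<in> generate G A \<Longrightarrow> c \<otimes> h \<otimes> inv c \<in> generate G A"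
    and g: "g \<in> generate G A"
  shows "inv c \<otimes> g \<otimes> c \<in> generate G A"
proof (rule ccontr)
  assume out: "inv c \<otimes> g \<otimes> c \<notin> generate G A"
  let ?H = "generate G A" and ?b = "inv c \<otimes> g \<otimes> c"
  have H: "?H \<subseteq> carrier G" using generate_in_carrier[OF A(2)] by blast
  obtain Y :: "'a set set" and \<phi> x where Y: "finite Y" "\<phi> \<in> hom G (perm_group Y)"
    and fixed: "\<And>k. k \<in> ?H \<Longrightarrow> \<phi> k x = x"
    and moved: "\<And>b. b \<in> {?b} \<Longrightarrow> b \<notin> ?H \<Longrightarrow> \<phi> b x \<noteq> x"
    by (rule finitely_generated_separable[OF S A, of "{?b}"]) (use c g H in auto)
  interpret h: group_hom G "perm_group Y" \<phi>
    using Y(2) group_perm_group by (auto simp: group_hom_def group_hom_axioms_def)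
  let ?C = "\<lambda>p. \<phi> c \<otimes>\<^bsub>perm_group Y\<^esub> p \<otimes>\<^bsub>perm_group Y\<^esub> inv\<^bsub>perm_group Y\<^esub> (\<phi> c)"
  have fin: "finite (\<phi> ` ?H)"
    by (rule finite_subset[OF _ finite_permutations[OF Y(1)]]) (use h.hom_closed H in auto)
  have img: "\<phi> ` ?H \<subseteq> carrier (perm_group Y)" using h.hom_closed H by blast
  have "?C ` \<phi> ` ?H \<subseteq> \<phi> ` ?H"
  proof clarify
    fix h assume h: "h \<in> ?H"
    then have "?C (\<phi> h) = \<phi> (c \<otimes> h \<otimes> inv c)" using c H by (auto simp del: perm_group_simps)
    then show "?C (\<phi> h) \<in> \<phi> ` ?H" using sub[OF h] by simp
  qed
  moreover have "inj_on ?C (\<phi> ` ?H)"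
  proof (rule inj_onI)
    fix p q assume "p \<in> \<phi> ` ?H" "q \<in> \<phi> ` ?H" and eq: "?C p = ?C q"
    then have "p \<in> carrier (perm_group Y)" "q \<in> carrier (perm_group Y)" using img by blast+
    then show "p = q" using eq h.hom_closed[OF c] by (simp del: perm_group_simps)
  qed
  ultimately have "?C ` \<phi> ` ?H = \<phi> ` ?H" by (rule endo_inj_surj[OF fin])
  then have "\<phi> g \<in> ?C ` \<phi> ` ?H" using imageI[OF g] by (simp only:)
  then obtain h where h: "h \<in> ?H" "\<phi> g = ?C (\<phi> h)" by (elim imageE) (simp only:)
  have "\<phi> ?b = inv\<^bsub>perm_group Y\<^esub> (\<phi> c) \<otimes>\<^bsub>perm_group Y\<^esub> \<phi> g \<otimes>\<^bsub>perm_group Y\<^esub> \<phi> c"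
    using c g H by (auto simp del: perm_group_simps)
  also have "\<dots> = \<phi> h"
    using h.hom_closed[OF c] h.hom_closed[of h] h H unfolding h(2)
    by (simp add: h.H.m_assoc h.H.inv_mult_cancel subset_iff del: perm_group_simps)
  finally show False using moved[of ?b] out fixed[OF h(1)] by simp
qed

text \<open>Separability of the trivial subgroup gives a homomorphism \<open>\<psi>\<close> into the
  permutations of a finite set \<open>V\<close> that kills no nonempty short reduced word. Left
  translation on all permutations of \<open>V\<close> makes nontrivial images act without fixed
  points.\<close>

lemma short_words_act_freely:
  assumes S: "free_basis G S" and T: "finite T" "T \<subseteq> S"
  obtains Z :: "('a set \<Rightarrow> 'a set) set" and \<rho> z where "finite Z" "z \<in> Z"
    "\<forall>s\<in>T. \<rho> s permutes Z"
    "\<forall>w\<in>reduced_words T. w \<noteq> [] \<longrightarrow> length w \<le> n \<longrightarrow> (\<forall>z\<in>Z. word_act \<rho> w z \<noteq> z)"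
proof -
  let ?val = "word_val G (\<lambda>x. x)"
  have i: "(\<lambda>x. x) \<in> S \<rightarrow> carrier G" and inj: "inj_on ?val (reduced_words S)"
    using S by (auto simp: free_basis_def bij_betw_def)
  have TS: "lists (T \<times> UNIV) \<subseteq> lists (S \<times> UNIV)" using T(2) by auto
  define B where "B = ?val ` {w \<in> reduced_words T. length w \<le> n}"
  have "finite {w \<in> reduced_words T. length w \<le> n}"
    by (rule finite_subset[OF _ finite_lists_length_le[of "T \<times> UNIV" n]])
       (use T(1) in \<open>auto simp: reduced_words_def\<close>)
  then have B: "finite B" "B \<subseteq> carrier G"
    using word_val_closed[OF i] TS by (auto simp: B_def reduced_words_def)
  obtain V :: "'a set set" and \<psi> x where V: "finite V" and \<psi>: "\<psi> \<in> hom G (perm_group V)"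
    and moved: "\<And>b. b \<in> B \<Longrightarrow> b \<notin> generate G {} \<Longrightarrow> \<psi> b x \<noteq> x"
    by (rule finitely_generated_separable[OF S finite.emptyI _ B]) auto
  interpret h: group_hom G "perm_group V" \<psi>
    using \<psi> group_perm_group by (auto simp: group_hom_def group_hom_axioms_def)
  have perm: "\<psi> g permutes V" if "g \<in> carrier G" for g
    using h.hom_closed[OF that] by simp
  define Z where "Z = {z. z permutes V}"
  \<comment> \<open>The identity outside \<open>Z\<close> makes \<open>\<rho> s\<close> a
    permutation of \<open>Z\<close> in the sense of \<open>permutes\<close>.\<close>
  define \<rho> where "\<rho> s z = (if z \<in> Z then \<psi> s \<circ> z else z)" for s z
  have fin: "finite Z" using V by (simp add: Z_def finite_permutations)
  have \<rho>: "\<rho> s permutes Z" if "s \<in> S" for s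
  proof (rule inj_imp_permutes[OF _ fin])
    have s: "\<psi> s permutes V" using that i perm by auto
    show "inj_on (\<rho> s) Z"
      using permutes_inj[OF s] by (auto simp: inj_on_def \<rho>_def fun_eq_iff)
    show "\<rho> s z \<in> Z" if "z \<in> Z" for z
      using that s by (auto simp: Z_def \<rho>_def permutes_compose)
  qed (simp add: \<rho>_def)
  have act: "word_act \<rho> w z = \<psi> (?val w) \<circ> z"
    if w: "w \<in> lists (S \<times> UNIV)" and z: "z \<in> Z" for w z
    using w
  proof (induction w)
    case Nil
    then show ?case using h.hom_one by simp
  next
    case (Cons a w)
    have v: "?val w \<in> carrier G" using word_val_closed[OF i] Cons.hyps by auto
    obtain s e where a: "a = (s, e)" by (cases a)
    have s: "s \<in> S" "s \<in> carrier G" using Cons.hyps i a by auto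
    have Z: "\<psi> g \<circ> z \<in> Z" if "g \<in> carrier G" for g
      using perm[OF that] z by (simp add: Z_def permutes_compose)
    show ?case
    proof (cases e)
      case True
      have "\<rho> s (\<psi> (?val w) \<circ> z) = \<psi> s \<circ> \<psi> (?val w) \<circ> z"
        using Z[OF v] by (simp add: \<rho>_def comp_assoc)
      also have "\<psi> s \<circ> \<psi> (?val w) = \<psi> (?val (a # w))"
        using True h.hom_mult[OF s(2) v] by (simp add: a)
      finally show ?thesis
        using True Cons.IH by (simp only: a word_act_simps letter_act.simps if_True)
    next
      case False
      have "\<psi> s \<circ> \<psi> (inv s \<otimes> ?val w) = \<psi> (?val w)"
        using h.hom_mult[of s "inv s \<otimes> ?val w"] s(2) v by (simp add: inv_mult_cancel)
      then have "\<rho> s (\<psi> (inv s \<otimes> ?val w) \<circ> z) = \<psi> (?val w) \<circ> z"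
        using Z[of "inv s \<otimes> ?val w"] s(2) v by (simp add: \<rho>_def flip: comp_assoc)
      then show ?thesis
        using False permutes_inv_eq[OF \<rho>[OF s(1)]]
        by (simp only: a word_act_simps letter_act.simps letter_val.simps word_val.simps
            if_False Cons.IH)
    qed
  qed
  show thesis
  proof (rule that[OF fin])
    show "id \<in> Z" by (simp add: Z_def permutes_id)
    show "\<forall>s\<in>T. \<rho> s permutes Z" using \<rho> T(2) by blast
    show "\<forall>w\<in>reduced_words T. w \<noteq> [] \<longrightarrow> length w \<le> n \<longrightarrow> (\<forall>z\<in>Z. word_act \<rho> w z \<noteq> z)"
    proof (intro ballI impI notI)
      fix w z
      assume w: "w \<in> reduced_words T" "w \<noteq> []" "length w \<le> n"
        and z: "z \<in> Z" "word_act \<rho> w z = z"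
      have wS: "w \<in> reduced_words S" using reduced_words_mono[OF T(2)] w(1) by blast
      have "\<psi> (?val w) \<circ> z = z" using act[OF reduced_words_lists[OF wS] z(1)] z(2) by simp
      \<comment> \<open>Evaluation at \<open>inv' z x\<close> cancels \<open>z\<close> and exhibits
        \<open>x\<close> as a fixed point.\<close>
      then have "\<psi> (?val w) (z (inv' z x)) = z (inv' z x)" by (metis comp_apply)
      then have "\<psi> (?val w) x = x" using z(1) by (simp add: Z_def permutes_inverses)
      then have "?val w \<in> generate G {}" using moved w by (auto simp: B_def)
      then have "?val w = ?val []" by (simp add: generate_empty)
      then show False using inj wS w(2) by (auto simp: inj_on_def reduced_words_def)
    qed
  qed
qed

text \<open>Hypothesis and conclusion speak of the generators \<open>B\<close>, so that only
  finitely many words have to be followed; a common fixed point of \<open>B\<close> is one of the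
  subgroup it generates.\<close>

lemma finitely_generated_into_conjugacy_separable:
  assumes S: "free_basis G S" and A: "finite A" "A \<subseteq> carrier G"
    and B: "finite B" "B \<subseteq> carrier G"
    and no_conj: "\<forall>g\<in>carrier G. \<exists>b\<in>B. g \<otimes> b \<otimes> inv g \<notin> generate G A"
  obtains V :: "('a set + ('a \<times> 'a set) \<times> ('a set \<Rightarrow> 'a set)) set" and \<phi> x where
    "finite V" "\<phi> \<in> hom G (perm_group V)" "x \<in> V"
    "\<forall>k\<in>generate G A. \<phi> k x = x" "\<forall>v\<in>V. \<exists>b\<in>B. \<phi> b v \<noteq> v"
proof -
  let ?val = "word_val G (\<lambda>x. x)"
  let ?K = "generate G A"
  have K: "subgroup ?K G" by (rule generate_is_subgroup[OF A(2)])
  have S': "S \<subseteq> carrier G" and i: "(\<lambda>x. x) \<in> S \<rightarrow> carrier G"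
    using S by (auto simp: free_basis_def)
  \<comment> \<open>Conjugation by \<open>\<one>\<close> yields a generator outside
    \<open>?K\<close>, in particular a nontrivial one.\<close>
  obtain b0 where b0: "b0 \<in> B" "b0 \<notin> ?K" "b0 \<in> carrier G"
    using no_conj[rule_format, OF one_closed] B(2) by auto
  have "b0 \<in> ?val ` reduced_words S" using S b0(3) by (simp add: free_basis_def bij_betw_def)
  then obtain u where u: "u \<in> reduced_words S" "b0 = ?val u" by (elim imageE)
  obtain c w0 where c: "c \<in> carrier G" and w0: "w0 @ w0 \<in> reduced_words S"
    and cw: "c \<otimes> b0 \<otimes> inv c = ?val w0"
    using conj_cyclically_reduced[OF i u(1)] unfolding u(2) by blast
  have "w0 \<noteq> []"
  proof
    assume "w0 = []"
    then have "c \<otimes> b0 = c" using cw c b0(3) by (simp add: inv_solve_right')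
    then have "b0 = \<one>" using c b0(3) by simp
    then show False using b0(2) generate.one[of G A] by metis
  qed
  let ?C = "\<lambda>b. c \<otimes> b \<otimes> inv c"
  have CB: "finite (A \<union> ?C ` B)" "A \<union> ?C ` B \<subseteq> carrier G" using A B c by auto
  obtain W where W: "finite W" "W \<subseteq> reduced_words S" "?val ` W = A \<union> ?C ` B"
    by (rule finite_reduced_words_exist[OF S CB])
  \<comment> \<open>Besides \<open>w0\<close>, which represents the conjugate of \<open>b0\<close>,
    these are words for \<open>A\<close> and for the conjugates by \<open>c\<close> of all of
    \<open>B\<close>. The bound \<open>n\<close> covers all of them.\<close>
  define W' where "W' = insert w0 W"
  \<comment> \<open>Only finitely many basis elements occur, which lets an arbitrary basis be
    handled by a finite graft.\<close>
  define T where "T = fst ` (\<Union>w\<in>W'. set w)"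
  have W'S: "finite W'" "W' \<subseteq> reduced_words S"
    using W w0 by (auto simp: W'_def reduced_words_append)
  have T: "finite T" using W'S(1) by (simp add: T_def)
  have TS: "T \<subseteq> S" using W'S(2) by (fastforce simp: T_def reduced_words_def)
  have w0T: "w0 @ w0 \<in> reduced_words T"
    using w0 by (rule reduced_words_letters) (auto simp: T_def W'_def)
  have W'T: "W' \<subseteq> reduced_words T"
  proof
    fix w assume w: "w \<in> W'"
    then have "w \<in> reduced_words S" using W'S(2) by blast
    then show "w \<in> reduced_words T" by (rule reduced_words_letters) (use w in \<open>auto simp: T_def\<close>)
  qed
  have W'l: "W' \<subseteq> lists (T \<times> UNIV)" using W'T by (auto simp: reduced_words_def)
  obtain n where n: "\<forall>w\<in>W'. length w \<le> n"
    using W'S(1) finite_imageI[of W' length] finite_nat_set_iff_bounded_le by auto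
  have T': "T \<subseteq> carrier G" using TS S' by blast
  obtain Y \<pi> where Y: "finite Y" "?K \<in> Y" "Y \<subseteq> (\<lambda>g. g <# ?K) ` carrier G"
    and \<pi>: "\<forall>s\<in>T. \<pi> s permutes Y"
    "\<forall>s\<in>T. \<forall>y\<in>Y. coset_act G ?K s y \<in> Y \<longrightarrow> \<pi> s y = coset_act G ?K s y"
    and stay: "\<forall>w\<in>W'. \<forall>v. suffix v w \<longrightarrow> word_act (coset_act G ?K) v ?K \<in> Y"
    by (rule finite_coset_completion[OF K T' W'S(1) W'l]) blast
  obtain Z :: "('a set \<Rightarrow> 'a set) set" and \<rho> z0 where Z: "finite Z" "z0 \<in> Z"
    and \<rho>: "\<forall>s\<in>T. \<rho> s permutes Z"
    and free: "\<forall>w\<in>reduced_words T. w \<noteq> [] \<longrightarrow> length w \<le> n \<longrightarrow> (\<forall>z\<in>Z. word_act \<rho> w z \<noteq> z)"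
    by (rule short_words_act_freely[OF S T TS, of n]) blast
  interpret g: grafting "coset_act G ?K" \<pi> \<rho> T Y Z z0 n
  proof
    show "bij (coset_act G ?K s)" if "s \<in> T" for s using bij_coset_act[OF K] that T' by blast
  qed (use T Y(1) Z \<pi> \<rho> free in \<open>simp_all\<close>)
  \<comment> \<open>Basis elements outside \<open>T\<close> act trivially.\<close>
  define \<tau> where "\<tau> s = (if s \<in> T then g.graft s else id)" for s
  have \<tau>: "\<tau> s permutes g.points" for s by (simp add: \<tau>_def g.graft_permutes permutes_id)
  obtain \<phi> where hom: "\<phi> \<in> hom G (perm_group g.points)"
    and \<phi>: "\<forall>w\<in>lists (S \<times> UNIV). \<phi> (?val w) = word_act \<tau> w"
    by (rule free_basis_perm_hom[OF S, of \<tau>, OF \<tau>]) blast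
  interpret h: group_hom G "perm_group g.points" \<phi>
    using hom group_perm_group by (auto simp: group_hom_def group_hom_axioms_def)
  have act: "\<phi> (?val w) = word_act g.graft w" if "w \<in> W'" for w
  proof -
    have w: "w \<in> lists (T \<times> UNIV)" using W'l that by blast
    then have "w \<in> lists (S \<times> UNIV)" using TS by auto
    moreover have "word_act \<tau> w = word_act g.graft w"
      by (rule word_act_cong[OF w]) (simp add: \<tau>_def)
    ultimately show ?thesis using \<phi> by simp
  qed
  have val_W: "\<exists>w\<in>W'. ?val w = d" if "d \<in> A \<union> ?C ` B" for d
  proof -
    have "d \<in> ?val ` W" using that by (simp only: W(3))
    then show ?thesis by (auto simp: W'_def)
  qed
  have fixes_A: "\<phi> a (Inl ?K) = Inl ?K" if a: "a \<in> A" for a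
  proof -
    obtain w where w: "w \<in> W'" "?val w = a" using val_W a by blast
    have wl: "w \<in> lists (T \<times> UNIV)" using W'l w by blast
    have aK: "a \<in> ?K" "a \<in> carrier G" using a A(2) generate.incl by auto
    have "word_act (coset_act G ?K) w (\<one> <# ?K) = a <# ?K"
      using word_act_coset[OF K T' wl one_closed] w(2) aK by simp
    then have "word_act (coset_act G ?K) w ?K = ?K"
      using coset_eq_self_iff[OF K] aK K by (simp add: lcos_mult_one subgroup.subset)
    then show ?thesis
      using g.word_act_agrees[OF wl, of ?K] stay w act by auto
  qed
  have moved: "\<exists>b\<in>B. \<phi> b v \<noteq> v" if v: "v \<in> g.points" for v
  proof (rule ccontr)
    assume "\<not> (\<exists>b\<in>B. \<phi> b v \<noteq> v)"
    then have fixed: "\<phi> b v = v" if "b \<in> B" for b using that by blast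
    have perm: "\<phi> c permutes g.points" using h.hom_closed[OF c] by simp
    \<comment> \<open>The point \<open>\<phi> c v\<close> is fixed by the conjugates of
      \<open>B\<close>, among them the value of the cyclically reduced word
      \<open>w0\<close>.\<close>
    have fixed': "\<phi> (?C b) (\<phi> c v) = \<phi> c v" if b: "b \<in> B" for b
    proof -
      have "\<phi> (?C b) \<circ> \<phi> c = \<phi> (?C b \<otimes> c)"
        using h.hom_mult[of "?C b" c] b B(2) c by auto
      also have "?C b \<otimes> c = c \<otimes> b" using b B(2) c by (auto simp: m_assoc)
      also have "\<phi> (c \<otimes> b) = \<phi> c \<circ> \<phi> b" using h.hom_mult[of c b] b B(2) c by auto
      finally show ?thesis using fixed[OF b] by (metis comp_apply)
    qed
    have v': "\<phi> c v \<in> g.points" using v perm by (simp add: permutes_in_image)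
    have "word_act g.graft w0 (\<phi> c v) = \<phi> c v"
      using fixed'[OF b0(1)] act[of w0] cw by (simp add: W'_def)
    then have "\<phi> c v \<in> Inl ` Y"
      using g.cyclically_reduced_fixed_in_Y[OF w0T \<open>w0 \<noteq> []\<close> _ v'] n by (simp add: W'_def)
    then obtain y where y: "y \<in> Y" "\<phi> c v = Inl y" by blast
    obtain g where g: "g \<in> carrier G" "y = g <# ?K" using y(1) Y(3) by blast
    \<comment> \<open>If every \<open>?C b\<close> fixed the coset of \<open>g\<close>, conjugation
      by \<open>inv g \<otimes> c\<close> would carry \<open>B\<close> into
      \<open>?K\<close>.\<close>
    have "\<exists>b\<in>B. (inv g \<otimes> c) \<otimes> b \<otimes> inv (inv g \<otimes> c) \<notin> ?K"
      using no_conj g(1) c by blast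
    then obtain b where b: "b \<in> B" "(inv g \<otimes> c) \<otimes> b \<otimes> inv (inv g \<otimes> c) \<notin> ?K" by blast
    have bG: "b \<in> carrier G" using b B(2) by blast
    obtain w where w: "w \<in> W'" "?val w = ?C b" using val_W b(1) by blast
    have wl: "w \<in> lists (T \<times> UNIV)" using W'l w by blast
    have "word_act g.graft w (Inl y) = Inl y"
      using fixed'[OF b(1)] act[OF w(1)] w(2) y(2) by simp
    then have "word_act (coset_act G ?K) w y = y"
      using g.fixed_in_Y[OF y(1), of w] W'T n w(1) by blast
    then have "(?C b \<otimes> g) <# ?K = g <# ?K"
      using word_act_coset[OF K T' wl g(1)] g(2) w(2) by simp
    then have "inv g \<otimes> ?C b \<otimes> g \<in> ?K"
      using coset_eq_iff[OF K, of "?C b" g] c bG g(1) by simp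
    moreover have "inv g \<otimes> ?C b \<otimes> g = (inv g \<otimes> c) \<otimes> b \<otimes> inv (inv g \<otimes> c)"
      using c bG g(1) by (simp add: inv_mult_group m_assoc)
    ultimately show False using b(2) by simp
  qed
  show thesis
  proof (rule that[OF g.finite_points hom])
    show "Inl ?K \<in> g.points" using Y(2) by (simp add: g.points_def)
    show "\<forall>k\<in>?K. \<phi> k (Inl ?K) = Inl ?K"
      using generate_fixes[OF hom A(2) fixes_A] by blast
    show "\<forall>v\<in>g.points. \<exists>b\<in>B. \<phi> b v \<noteq> v" using moved by blast
  qed
qed

end


section \<open>Subgroup conjugacy separability\<close>

lemma conjugate_subgroups_iff:
  "conjugate_subgroups G H K \<longleftrightarrow>
     (\<exists>g\<in>carrier G. K = (\<lambda>h. g \<otimes>\<^bsub>G\<^esub> h \<otimes>\<^bsub>G\<^esub> inv\<^bsub>G\<^esub> g) ` H)"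
proof -
  have "g <#\<^bsub>G\<^esub> H #>\<^bsub>G\<^esub> inv\<^bsub>G\<^esub> g = (\<lambda>h. g \<otimes>\<^bsub>G\<^esub> h \<otimes>\<^bsub>G\<^esub> inv\<^bsub>G\<^esub> g) ` H" for g
    by (auto simp: l_coset_def r_coset_def)
  then show ?thesis by (simp add: conjugate_subgroups_def)
qed

text \<open>An isomorphism onto a group on \<open>nat\<close> reflects conjugacy: the conjugating
  element is pulled back by surjectivity, and the equation of sets by injectivity.\<close>

lemma separating_hom_nat:
  fixes G :: "('a, 'b) monoid_scheme" and R :: "('c, 'd) monoid_scheme"
  assumes G: "group G" and R: "group R" "finite (carrier R)" and hom: "\<psi> \<in> hom G R"
    and H: "H1 \<subseteq> carrier G" "H2 \<subseteq> carrier G"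
    and nc: "\<not> conjugate_subgroups R (\<psi> ` H1) (\<psi> ` H2)"
  shows "\<exists>(Q :: nat monoid) \<phi>. group Q \<and> finite (carrier Q) \<and> \<phi> \<in> hom G Q \<and>
           \<not> conjugate_subgroups Q (\<phi> ` H1) (\<phi> ` H2)"
proof -
  obtain Q :: "nat monoid" and r where Q: "group Q" "finite (carrier Q)" and r: "r \<in> iso R Q"
    using finite_group_iso_nat[OF R] by (auto simp: is_iso_def)
  have rh: "r \<in> hom R Q" and inj: "inj_on r (carrier R)" and surj: "r ` carrier R = carrier Q"
    using r by (auto simp: iso_def bij_betw_def)
  interpret r: group_hom R Q r
    using R(1) Q(1) rh by (simp add: group_hom_def group_hom_axioms_def)
  have sub: "\<psi> ` H1 \<subseteq> carrier R" "\<psi> ` H2 \<subseteq> carrier R"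
    using hom H by (auto simp: hom_def)
  have "\<not> conjugate_subgroups Q ((r \<circ> \<psi>) ` H1) ((r \<circ> \<psi>) ` H2)"
  proof
    assume "conjugate_subgroups Q ((r \<circ> \<psi>) ` H1) ((r \<circ> \<psi>) ` H2)"
    then obtain q where q: "q \<in> carrier Q"
      "r ` \<psi> ` H2 = (\<lambda>h. q \<otimes>\<^bsub>Q\<^esub> h \<otimes>\<^bsub>Q\<^esub> inv\<^bsub>Q\<^esub> q) ` r ` \<psi> ` H1"
      by (auto simp: conjugate_subgroups_iff image_comp)
    obtain p where p: "p \<in> carrier R" "q = r p" using q(1) surj by blast
    let ?c = "\<lambda>h. p \<otimes>\<^bsub>R\<^esub> h \<otimes>\<^bsub>R\<^esub> inv\<^bsub>R\<^esub> p"
    have "(\<lambda>h. q \<otimes>\<^bsub>Q\<^esub> h \<otimes>\<^bsub>Q\<^esub> inv\<^bsub>Q\<^esub> q) ` r ` M = r ` ?c ` M" if "M \<subseteq> carrier R" for M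
      unfolding image_image using p that by (intro image_cong) auto
    from this[OF sub(1)] have eq: "r ` \<psi> ` H2 = r ` ?c ` \<psi> ` H1" using q(2) by (simp only:)
    have "?c x \<in> carrier R" if "x \<in> carrier R" for x using p(1) that by simp
    then have "?c ` \<psi> ` H1 \<subseteq> carrier R" using sub(1) by blast
    then have "\<psi> ` H2 = ?c ` \<psi> ` H1"
      using eq inj_on_image_eq_iff[OF inj sub(2)] by (simp only:)
    then show False using nc p(1) unfolding conjugate_subgroups_iff by (elim notE) (rule bexI)
  qed
  moreover have "r \<circ> \<psi> \<in> hom G Q" using hom rh by (rule hom_compose)
  ultimately show ?thesis using Q by blast
qed

text \<open>A conjugating permutation carries fixed points to fixed points. Both orders are recorded
  because either given subgroup may be the one without a fixed point.\<close>

lemma not_conjugate_if_fixed_point: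
  assumes sub: "P1 \<subseteq> carrier (perm_group V)" "P2 \<subseteq> carrier (perm_group V)"
    and x: "x \<in> V" "\<forall>p\<in>P2. p x = x" and moved: "\<forall>v\<in>V. \<exists>p\<in>P1. p v \<noteq> v"
  shows "\<not> conjugate_subgroups (perm_group V) P1 P2" "\<not> conjugate_subgroups (perm_group V) P2 P1"
proof -
  show "\<not> conjugate_subgroups (perm_group V) P1 P2"
  proof
    assume "conjugate_subgroups (perm_group V) P1 P2"
    then obtain q where q: "q permutes V" "P2 = (\<lambda>p. q \<circ> p \<circ> inv' q) ` P1"
      by (auto simp: conjugate_subgroups_iff inv_perm_group)
    have "p (inv' q x) = inv' q x" if "p \<in> P1" for p
    proof -
      have "q (p (inv' q x)) = x" using x(2) q(2) that by auto
      then show ?thesis using permutes_inv_eq[OF q(1)] by metis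
    qed
    moreover have "inv' q x \<in> V" using x(1) permutes_in_image[OF permutes_inv[OF q(1)]] by simp
    ultimately show False using moved by blast
  qed
  show "\<not> conjugate_subgroups (perm_group V) P2 P1"
  proof
    assume "conjugate_subgroups (perm_group V) P2 P1"
    then obtain q where q: "q permutes V" "P1 = (\<lambda>p. q \<circ> p \<circ> inv' q) ` P2"
      by (auto simp: conjugate_subgroups_iff inv_perm_group)
    have "\<forall>p\<in>P1. p (q x) = q x" using x(2) by (auto simp: q(2) permutes_inverses[OF q(1)])
    moreover have "q x \<in> V" using x(1) permutes_in_image[OF q(1)] by simp
    ultimately show False using moved by blast
  qed
qed

lemma (in group) separating_hom_if_not_into_conjugate:
  assumes S: "free_basis G S" and A: "finite A" "A \<subseteq> carrier G"
    and B: "finite B" "B \<subseteq> carrier G"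
    and no_conj: "\<forall>g\<in>carrier G. \<exists>b\<in>B. g \<otimes> b \<otimes> inv g \<notin> generate G A"
    and H: "(H1, H2) = (generate G B, generate G A) \<or> (H1, H2) = (generate G A, generate G B)"
  shows "\<exists>(Q :: nat monoid) \<phi>. group Q \<and> finite (carrier Q) \<and> \<phi> \<in> hom G Q \<and>
           \<not> conjugate_subgroups Q (\<phi> ` H1) (\<phi> ` H2)"
proof -
  obtain V :: "('a set + ('a \<times> 'a set) \<times> ('a set \<Rightarrow> 'a set)) set" and \<phi> x where
    V: "finite V" and hom: "\<phi> \<in> hom G (perm_group V)" and x: "x \<in> V"
    and fixed: "\<forall>k\<in>generate G A. \<phi> k x = x" and moved: "\<forall>v\<in>V. \<exists>b\<in>B. \<phi> b v \<noteq> v"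
    by (rule finitely_generated_into_conjugacy_separable[OF S A B no_conj])
  have sub: "generate G A \<subseteq> carrier G" "generate G B \<subseteq> carrier G"
    using generate_in_carrier A(2) B(2) by blast+
  then have img: "\<phi> ` generate G B \<subseteq> carrier (perm_group V)"
    "\<phi> ` generate G A \<subseteq> carrier (perm_group V)"
    using hom by (auto simp: hom_def)
  have fixed': "\<forall>p\<in>\<phi> ` generate G A. p x = x" using fixed by simp
  have moved': "\<forall>v\<in>V. \<exists>p\<in>\<phi> ` generate G B. p v \<noteq> v"
    using moved generate.incl by (metis imageI)
  have "\<not> conjugate_subgroups (perm_group V) (\<phi> ` H1) (\<phi> ` H2)"
    using not_conjugate_if_fixed_point[OF img x fixed' moved'] H by auto
  then show ?thesis
    using sub H V by (intro separating_hom_nat[OF is_group group_perm_group _ hom])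
      (auto simp: finite_permutations)
qed

lemma (in group) conjugate_if_mutually_into_conjugate:
  assumes S: "free_basis G S" and A: "finite A" "A \<subseteq> carrier G"
    and B: "finite B" "B \<subseteq> carrier G"
    and g: "g \<in> carrier G" "\<forall>a\<in>A. g \<otimes> a \<otimes> inv g \<in> generate G B"
    and k: "k \<in> carrier G" "\<forall>b\<in>B. k \<otimes> b \<otimes> inv k \<in> generate G A"
  shows "conjugate_subgroups G (generate G A) (generate G B)"
proof -
  let ?H = "generate G A" and ?K = "generate G B"
  have HG: "?H \<subseteq> carrier G" "?K \<subseteq> carrier G"
    using generate_in_carrier A(2) B(2) by blast+
  have into_K: "g \<otimes> h \<otimes> inv g \<in> ?K" if "h \<in> ?H" for h
    using generate_conj_subset[OF A(2) generate_is_subgroup[OF B(2)] g(1) _ that] g(2) by blast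
  have into_H: "k \<otimes> h \<otimes> inv k \<in> ?H" if "h \<in> ?K" for h
    using generate_conj_subset[OF B(2) generate_is_subgroup[OF A(2)] k(1) _ that] k(2) by blast
  have self: "(k \<otimes> g) \<otimes> h \<otimes> inv (k \<otimes> g) \<in> ?H" if h: "h \<in> ?H" for h
  proof -
    have "(k \<otimes> g) \<otimes> h \<otimes> inv (k \<otimes> g) = k \<otimes> (g \<otimes> h \<otimes> inv g) \<otimes> inv k"
      using g(1) k(1) h HG by (auto simp: inv_mult_group m_assoc subset_iff)
    then show ?thesis using into_H[OF into_K[OF h]] by simp
  qed
  have "?K \<subseteq> (\<lambda>h. g \<otimes> h \<otimes> inv g) ` ?H"
  proof
    fix y assume y: "y \<in> ?K"
    then have yG: "y \<in> carrier G" using HG by blast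
    have "inv (k \<otimes> g) \<otimes> (k \<otimes> y \<otimes> inv k) \<otimes> (k \<otimes> g) \<in> ?H"
      using finitely_generated_conj_subset_eq[OF S A _ self into_H[OF y]] g(1) k(1) by blast
    also have "inv (k \<otimes> g) \<otimes> (k \<otimes> y \<otimes> inv k) \<otimes> (k \<otimes> g) = inv g \<otimes> y \<otimes> g"
      using g(1) k(1) yG by (simp add: inv_mult_group m_assoc inv_mult_cancel)
    finally have "inv g \<otimes> y \<otimes> g \<in> ?H" .
    moreover have "y = g \<otimes> (inv g \<otimes> y \<otimes> g) \<otimes> inv g"
      using g(1) yG by (simp add: m_assoc inv_mult_cancel)
    ultimately show "y \<in> (\<lambda>h. g \<otimes> h \<otimes> inv g) ` ?H" by (rule rev_image_eqI)
  qed
  then have "?K = (\<lambda>h. g \<otimes> h \<otimes> inv g) ` ?H" using into_K by blast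
  then show ?thesis using g(1) unfolding conjugate_subgroups_iff by blast
qed

theorem theorem1p3:
  fixes F :: "('a, 'b) monoid_scheme"
  assumes "free_group F"
  shows "subgroup_conjugacy_separable F"
proof -
  have "group F" using assms by (simp add: free_group_def)
  then interpret group F .
  obtain S where S: "free_basis F S" using assms unfolding free_group_def by blast
  have "\<exists>(Q :: nat monoid) \<phi>. group Q \<and> finite (carrier Q) \<and> \<phi> \<in> hom F Q \<and>
      \<not> conjugate_subgroups Q (\<phi> ` H1) (\<phi> ` H2)"
    if fg: "finitely_generated_subgroup F H1" "finitely_generated_subgroup F H2"
      and nc: "\<not> conjugate_subgroups F H1 H2" for H1 H2
  proof -
    obtain A where A: "finite A" "A \<subseteq> carrier F" "H1 = generate F A"
      using fg(1) unfolding finitely_generated_subgroup_def by blast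
    obtain B where B: "finite B" "B \<subseteq> carrier F" "H2 = generate F B"
      using fg(2) unfolding finitely_generated_subgroup_def by blast
    \<comment> \<open>If both alternatives failed, each subgroup would have a conjugate inside the
      other, and the two would be conjugate.\<close>
    have "(\<forall>g\<in>carrier F. \<exists>a\<in>A. g \<otimes>\<^bsub>F\<^esub> a \<otimes>\<^bsub>F\<^esub> inv\<^bsub>F\<^esub> g \<notin> H2) \<or>
        (\<forall>g\<in>carrier F. \<exists>b\<in>B. g \<otimes>\<^bsub>F\<^esub> b \<otimes>\<^bsub>F\<^esub> inv\<^bsub>F\<^esub> g \<notin> H1)"
      using conjugate_if_mutually_into_conjugate[OF S A(1,2) B(1,2)] nc unfolding A(3) B(3)
      by blast
    then show ?thesis
    proof
      assume "\<forall>g\<in>carrier F. \<exists>a\<in>A. g \<otimes>\<^bsub>F\<^esub> a \<otimes>\<^bsub>F\<^esub> inv\<^bsub>F\<^esub> g \<notin> H2"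
      \<comment> \<open>Here \<open>H2\<close> is the subgroup that receives a fixed point, so the
        generating sets enter in exchanged roles.\<close>
      then show ?thesis unfolding A(3) B(3)
        by (rule separating_hom_if_not_into_conjugate[OF S B(1,2) A(1,2)]) simp
    next
      assume "\<forall>g\<in>carrier F. \<exists>b\<in>B. g \<otimes>\<^bsub>F\<^esub> b \<otimes>\<^bsub>F\<^esub> inv\<^bsub>F\<^esub> g \<notin> H1"
      then show ?thesis unfolding A(3) B(3)
        by (rule separating_hom_if_not_into_conjugate[OF S A(1,2) B(1,2)]) simp
    qed
  qed
  then show ?thesis
    unfolding subgroup_conjugacy_separable_def using is_group by blast
qed

end
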